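(* Let $\{a_n\}_{n\ge0}$ be a periodic sequence of real numbers with minimal even period $p\ge 2$, let $$\sigma=\sum_{j=1}^{p}(-1)^ja_{j-1}=-a_0+a_1-a_2+\cdots+a_{p-1},$$ and consider the difference equation $$x_{n+1}=x_{n-1}e^{a_n-x_{n-1}-x_n},\qquad n\ge0. \tag{E}$$ (a) If $\sigma>0$ and $0<a_{2k-1}<2$ for $k=1,2,\dots,p/2$, then (E) has a globally attracting periodic solution $\{\bar x_n\}$ with period $p$ such that $\bar x_{2n-1}=0$ for all $n$ and $\{\bar x_{2n}\}$ is a sequence of period $p/2$ satisfying $$\sum_{i=1}^{p/2}\bar x_{2i-2}=\sum_{i=1}^{p/2}a_{2i-1}.$$ (b) If $\sigma<0$ and $0<a_{2k-2}<2$ for $k=1,2,\dots,p/2$, then (E) has a globally attracting periodic solution $\{\bar x_n\}$ with period $p$ such that $\bar x_{2n}=0$ for all $n$ and $\{\bar x_{2n-1}\}$ is a sequence of period $p/2$ satisfying $$\sum_{i=1}^{p/2}\bar x_{2i-1}=\sum_{i=1}^{p/2}a_{2i-2}.$$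
   Context: A sequence has period $m$ if it is unchanged by the index shift $n\mapsto n+m$; $m$ need not be the minimal period unless "minimal" is stated. A periodic solution $\{\bar x_n\}$ of (E) is globally attracting if every solution $\{x_n\}$ of (E) with initial values $x_{-1},x_0>0$ satisfies $\lim_{n\to\infty}|x_n-\bar x_n|=0$. *)

theory Defs
  imports Complex_Main
begin

definition has_period :: "nat \<Rightarrow> (nat \<Rightarrow> real) \<Rightarrow> bool" where
  "has_period m s \<longleftrightarrow> 0 < m \<and> (\<forall>n. s (n + m) = s n)"

definition minimal_period :: "nat \<Rightarrow> (nat \<Rightarrow> real) \<Rightarrow> bool" where
  "minimal_period m s \<longleftrightarrow> has_period m s \<and> (\<forall>q. has_period q s \<longrightarrow> m \<le> q)"

text \<open>
  Solutions start at index \<open>-1\<close>, so a solution is a function on the integers of which only the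
  values at indices \<open>\<ge> -1\<close> matter; the values at smaller indices are unconstrained.
  Initial values are arbitrary reals, since a periodic solution may vanish at
  every index of one parity.
\<close>

definition is_solution :: "(nat \<Rightarrow> real) \<Rightarrow> (int \<Rightarrow> real) \<Rightarrow> bool" where
  "is_solution a x \<longleftrightarrow>
     (\<forall>n::nat. x (int n + 1) = x (int n - 1) * exp (a n - x (int n - 1) - x (int n)))"

definition periodic_solution :: "(nat \<Rightarrow> real) \<Rightarrow> nat \<Rightarrow> (int \<Rightarrow> real) \<Rightarrow> bool" where
  "periodic_solution a m x \<longleftrightarrow> is_solution a x \<and> has_period m (\<lambda>n. x (int n - 1))"

definition globally_attracting :: "(nat \<Rightarrow> real) \<Rightarrow> (int \<Rightarrow> real) \<Rightarrow> bool" where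
  "globally_attracting a xbar \<longleftrightarrow>
     (\<forall>x. is_solution a x \<and> x (-1) > 0 \<and> x 0 > 0 \<longrightarrow>
        (\<lambda>n::nat. \<bar>x (int n) - xbar (int n)\<bar>) \<longlonglongrightarrow> 0)"

end

theory Submission
  imports Defs
begin

text \<open>
  Write \<open>y n = x (2 n - 1)\<close> and \<open>z n = x (2 n)\<close> for the two parity classes of a solution, and
  \<open>b n = a (2 n + 1)\<close>, \<open>c n = a (2 n)\<close>.  The equation becomes a competition model
  \[ y_{n+1} = y_n e^{c_n - y_n - z_n}, \qquad z_{n+1} = z_n e^{b_n - z_n - y_{n+1}}, \]
  whose coefficients have period \<open>m = p / 2\<close>, and \<open>\<sigma>\<close> is the sum of \<open>b - c\<close> over one period.

  The quantity \<open>ln y - y - ln z\<close> changes in each step by exactly \<open>c n - b n\<close>.  If \<open>\<sigma> > 0\<close>, it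
  therefore drifts to \<open>- \<infinity>\<close>, and since \<open>y\<close> and \<open>z\<close> are bounded this forces \<open>y \<longlonglongrightarrow> 0\<close>
  (\<open>weaker_competitor_vanishes\<close>).  What remains for \<open>z\<close> is the periodic Ricker recursion
  \<open>z \<mapsto> z exp (b n - z)\<close>, damped by a factor \<open>exp (- y)\<close> that tends to 1.

  The Ricker maps with \<open>r < 2\<close> share a metric that all of them contract.  In the coordinate
  \<open>ln z + z ^ 3 / 48\<close>, whose derivative is \<open>(1 + z ^ 3 / 16) / z\<close>, the derivative of
  \<open>z \<mapsto> z exp (r - z)\<close> is
  \[ \frac{1 + f(z)^3 / 16}{1 + z^3 / 16} (1 - z), \qquad f(z) = z e^{r - z}, \]
  and its absolute value is at most 1 for \<open>r = 2\<close> and all \<open>z > 0\<close> (\<open>weight_ricker_two_le\<close>), and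
  less than 1 for \<open>r < 2\<close>.  In the plain logarithmic coordinate this fails, because the
  derivative \<open>1 - z\<close> is less than \<open>-1\<close> where \<open>z > 2\<close>, and orbits can get there if \<open>r\<close> is close
  to 2.  At \<open>r = z = 2\<close> the map has multiplier \<open>-1\<close>, so that a weight \<open>\<phi>\<close> can only work
  if \<open>\<phi>' / \<phi> = 1 / 2\<close> at 2; the weight \<open>1 + z ^ 3 / 16\<close> is the one of the form \<open>1 + C z ^ 3\<close> with this property.

  On a compact interval the contraction is uniform, so two orbits approach each other even if
  one of them is subject to errors that tend to 0 (\<open>damped_ricker_tracking\<close>).  The intermediate
  value theorem gives a periodic Ricker orbit, and \<open>z\<close> approaches it.  Taking logarithms around
  one period shows that the orbit and \<open>b\<close> have the same sum.

  The case \<open>\<sigma> < 0\<close> is the case \<open>\<sigma> > 0\<close> for the sequence \<open>a\<close> shifted by one index, as the shift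
  exchanges the parity classes and changes the sign of \<open>\<sigma>\<close>.
\<close>

section \<open>Ricker maps\<close>

definition ricker :: "real \<Rightarrow> real \<Rightarrow> real" where
  "ricker r z = z * exp (r - z)"

lemma ricker_pos: "0 < z \<Longrightarrow> 0 < ricker r z"
  by (simp add: ricker_def)

lemma ricker_le_peak: "ricker r z \<le> exp (r - 1)"
proof -
  have "z \<le> exp (z - 1)"
    using exp_ge_add_one_self[of "z - 1"] by simp
  then have "ricker r z \<le> exp (z - 1) * exp (r - z)"
    unfolding ricker_def by (intro mult_right_mono) auto
  then show ?thesis
    by (simp add: exp_add[symmetric])
qed

text \<open>
  A lower barrier \<open>\<delta>\<close>: a point below \<open>\<alpha>\<close> is not decreased by the map, and a point of
  \<open>[\<alpha>, M]\<close> has an image at least \<open>\<alpha> exp (- M)\<close>.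
\<close>

lemma ricker_bounded_below:
  assumes "0 < \<alpha>" "\<alpha> \<le> r" "0 < \<delta>" "\<delta> \<le> \<alpha> * exp (- M)" "\<delta> \<le> z" "z \<le> M"
  shows "\<delta> \<le> ricker r z"
proof (cases "z \<le> \<alpha>")
  case True
  then have "z * 1 \<le> ricker r z"
    unfolding ricker_def using assms by (intro mult_left_mono) auto
  then show ?thesis
    using assms by simp
next
  case False
  have "\<alpha> * exp (- M) \<le> z * exp (r - z)"
    using False assms by (intro mult_mono) auto
  then show ?thesis
    using assms unfolding ricker_def by linarith
qed

section \<open>A metric contracted by the Ricker maps with parameter below 2\<close>

text \<open>
  The weight \<open>\<phi>\<close> of the metric \<open>\<phi> z dz / z\<close> on the positive reals, in which distances are
  differences of the antiderivative \<open>coord\<close> of \<open>\<phi> z / z\<close>.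
\<close>

definition weight :: "real \<Rightarrow> real" where
  "weight z = 1 + z ^ 3 / 16"

definition coord :: "real \<Rightarrow> real" where
  "coord z = ln z + z ^ 3 / 48"

text \<open>
  Left of the critical point 1 there is room to spare, so the exponential can be replaced by
  its cubic Taylor polynomial and \<open>e ^ 6\<close> by a numerical bound.
\<close>

lemma weight_ineq_left:
  fixes z :: real
  assumes "0 < z" "z < 1"
  shows "z\<^sup>2 * (1 - z) * exp (6 - 3 * z) < 16 + z\<^sup>2"
proof -
  have exp6: "exp (6::real) \<le> 480"
  proof -
    \<comment> \<open>The bound \<open>exp t \<le> 1 + t + t\<^sup>2\<close> is sharp enough only for a small \<open>t\<close>.\<close>
    have "exp (6::real) = exp (1 / 16) ^ 96"
      by (simp add: exp_of_nat_mult[symmetric])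
    also have "\<dots> \<le> (273 / 256) ^ 96"
      using exp_bound[of "1 / 16 :: real"] by (intro power_mono) (auto simp: power2_eq_square)
    also have "\<dots> \<le> (480 :: real)"
      by (simp add: power_divide)
    finally show ?thesis .
  qed
  have taylor: "1 + 3 * z + 9 / 2 * z\<^sup>2 + 9 / 2 * z ^ 3 \<le> exp (3 * z)"
  proof -
    have "(\<Sum>k<4. (3 * z) ^ k /\<^sub>R fact k) \<le> exp (3 * z)"
      unfolding exp_def using assms
      by (intro sum_le_suminf summable_exp_generic) auto
    then show ?thesis
      by (simp add: eval_nat_numeral algebra_simps)
  qed
  have poly: "480 * (z\<^sup>2 * (1 - z)) < 16 * (1 + 3 * z + 9 / 2 * z\<^sup>2 + 9 / 2 * z ^ 3)"
  proof -
    \<comment> \<open>The difference of the two sides is a cubic whose minimum lies near \<open>z = 0.42\<close>.\<close>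
    have "0 \<le> (z - 42 / 100)\<^sup>2 * (552 * z + 5568 / 100)"
      using assms by (intro mult_nonneg_nonneg) auto
    then show ?thesis
      using assms by (simp add: power2_eq_square power3_eq_cube algebra_simps)
  qed
  have "z\<^sup>2 * (1 - z) * exp 6 \<le> 480 * (z\<^sup>2 * (1 - z))"
    using exp6 assms by (simp add: mult_left_mono mult.commute)
  also note poly
  also have "16 * (1 + 3 * z + 9 / 2 * z\<^sup>2 + 9 / 2 * z ^ 3) \<le> 16 * exp (3 * z)"
    using taylor by simp
  also have "\<dots> \<le> (16 + z\<^sup>2) * exp (3 * z)"
    by (intro mult_right_mono) auto
  finally show ?thesis
    by (simp add: exp_diff field_simps)
qed

text \<open>
  Right of the critical point the inequality is sharp, with equality at \<open>z = 2\<close>.  The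
  logarithm \<open>h\<close> of the quotient of the two sides has a rational derivative, which factors as
  \<open>t - 2\<close> times a positive function; thus \<open>h\<close> has its minimum 0 at 2.
\<close>

lemma weight_ineq_right:
  fixes z :: real
  assumes "1 < z"
  shows "z ^ 3 * (z - 1) * exp (6 - 3 * z) \<le> 32 - 16 * z + z ^ 3"
proof -
  define h where "h = (\<lambda>t::real. ln (32 - 16 * t + t ^ 3) - 3 * ln t - ln (t - 1) - 6 + 3 * t)"
  define Q where "Q = (\<lambda>t::real. 3 * t ^ 4 + 2 * t ^ 3 - 44 * t\<^sup>2 + 104 * t - 48)"
  have pos: "0 < 32 - 16 * t + t ^ 3" if "1 < t" for t :: real
  proof -
    \<comment> \<open>The minimum is at \<open>sqrt (16 / 3)\<close>, which is close to \<open>7 / 3\<close>.\<close>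
    have "0 \<le> (3 * t - 7)\<^sup>2 * (3 * t + 14)"
      using that by (intro mult_nonneg_nonneg) auto
    then show ?thesis
      using that by (simp add: power2_eq_square power3_eq_cube algebra_simps)
  qed
  have Qpos: "0 < Q t" if "1 < t" for t
  proof -
    have "Q t = 3 * (t - 1) ^ 4 + (t - 1) * (14 * (t - 1 - 5 / 7)\<^sup>2 + 188 / 7) + 17"
      by (simp add: Q_def power2_eq_square eval_nat_numeral algebra_simps)
    moreover have "0 \<le> (t - 1) * (14 * (t - 1 - 5 / 7)\<^sup>2 + 188 / 7)"
      using that by (intro mult_nonneg_nonneg add_nonneg_nonneg) auto
    moreover have "0 \<le> 3 * (t - 1) ^ 4"
      by simp
    ultimately show ?thesis
      by (metis add_nonneg_nonneg add_nonneg_pos zero_less_numeral)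
  qed
  have dh: "(h has_real_derivative
      (t - 2) * Q t / ((32 - 16 * t + t ^ 3) * t * (t - 1))) (at t)" if "1 < t" for t
  proof -
    have "(h has_real_derivative
        ((3 * t\<^sup>2 - 16) / (32 - 16 * t + t ^ 3) - 3 / t - 1 / (t - 1) + 3)) (at t)"
      unfolding h_def using that pos[OF that] by (auto intro!: derivative_eq_intros)
    moreover have "(3 * t\<^sup>2 - 16) / (32 - 16 * t + t ^ 3) - 3 / t - 1 / (t - 1) + 3
        = (t - 2) * Q t / ((32 - 16 * t + t ^ 3) * t * (t - 1))"
    proof -
      define P where "P = 32 - 16 * t + t ^ 3"
      have "P \<noteq> 0" "t \<noteq> 0" "t - 1 \<noteq> 0"
        using pos[OF that] that by (auto simp: P_def)
      then have "(3 * t\<^sup>2 - 16) / P - 3 / t - 1 / (t - 1) + 3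
          = ((3 * t\<^sup>2 - 16) * t * (t - 1) - 3 * P * (t - 1) - P * t + 3 * P * t * (t - 1))
              / (P * t * (t - 1))"
        by (simp add: divide_simps) (simp add: algebra_simps)
      also have "(3 * t\<^sup>2 - 16) * t * (t - 1) - 3 * P * (t - 1) - P * t + 3 * P * t * (t - 1)
          = (t - 2) * Q t"
        unfolding P_def Q_def by (simp add: algebra_simps eval_nat_numeral)
      finally show ?thesis
        by (simp add: P_def)
    qed
    ultimately show ?thesis
      by simp
  qed
  have "h 2 \<le> h z"
  proof (cases "z \<le> 2")
    case True
    show ?thesis
    proof (rule DERIV_nonpos_imp_nonincreasing[OF True])
      fix t assume t: "z \<le> t" "t \<le> 2"
      then have "1 < t"
        using assms by simp
      moreover from this have "(t - 2) * Q t / ((32 - 16 * t + t ^ 3) * t * (t - 1)) \<le> 0"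
        using Qpos[of t] pos[of t] t by (intro divide_nonpos_pos mult_nonpos_nonneg mult_pos_pos) auto
      ultimately show "\<exists>d. (h has_real_derivative d) (at t) \<and> d \<le> 0"
        using dh by blast
    qed
  next
    case False
    then have "2 \<le> z" by simp
    then show ?thesis
    proof (rule DERIV_nonneg_imp_nondecreasing)
      fix t assume t: "2 \<le> t" "t \<le> z"
      then have "1 < t" by simp
      moreover from this have "(t - 2) * Q t / ((32 - 16 * t + t ^ 3) * t * (t - 1)) \<ge> 0"
        using Qpos[of t] pos[of t] t by (intro divide_nonneg_pos mult_nonneg_nonneg mult_pos_pos) auto
      ultimately show "\<exists>d. (h has_real_derivative d) (at t) \<and> 0 \<le> d"
        using dh by blast
    qed
  qed
  moreover have "h 2 = 0"
    using ln_realpow[of 2 3] by (simp add: h_def)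
  ultimately have "3 * ln z + ln (z - 1) + (6 - 3 * z) \<le> ln (32 - 16 * z + z ^ 3)"
    by (simp add: h_def)
  moreover have "3 * ln z + ln (z - 1) + (6 - 3 * z) = ln (z ^ 3 * (z - 1) * exp (6 - 3 * z))"
    using assms by (simp add: ln_mult ln_realpow)
  ultimately have "ln (z ^ 3 * (z - 1) * exp (6 - 3 * z)) \<le> ln (32 - 16 * z + z ^ 3)"
    by linarith
  then show ?thesis
    using pos[OF assms] assms by (subst (asm) ln_le_cancel_iff) auto
qed

text \<open>
  The derivative bound at the extreme parameter 2: after the cube of the Ricker map is written
  out, the two inequalities above are this bound on either side of 1.
\<close>

lemma weight_ricker_two_le:
  assumes "0 < z"
  shows "weight (ricker 2 z) * \<bar>1 - z\<bar> \<le> weight z"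
proof -
  have cube: "ricker 2 z ^ 3 = z ^ 3 * exp (6 - 3 * z)"
    by (simp add: ricker_def power_mult_distrib exp_of_nat_mult[symmetric] algebra_simps)
  consider "z < 1" | "z = 1" | "1 < z" by linarith
  then show ?thesis
  proof cases
    case 1
    have "z * (z\<^sup>2 * (1 - z) * exp (6 - 3 * z)) \<le> z * (16 + z\<^sup>2)"
      using weight_ineq_left[OF assms 1] assms by (intro mult_left_mono) auto
    then have "ricker 2 z ^ 3 * (1 - z) \<le> 16 * z + z ^ 3"
      unfolding cube by (simp add: power2_eq_square power3_eq_cube algebra_simps)
    then show ?thesis
      using 1 by (simp add: weight_def algebra_simps)
  next
    case 2
    then show ?thesis by (simp add: weight_def)
  next
    case 3
    have "ricker 2 z ^ 3 * (z - 1) \<le> 32 - 16 * z + z ^ 3"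
      using weight_ineq_right[OF 3] by (simp add: cube algebra_simps)
    then show ?thesis
      using 3 by (simp add: weight_def field_simps)
  qed
qed

lemma weight_pos: "0 \<le> z \<Longrightarrow> 0 < weight z"
  by (simp add: weight_def add_pos_nonneg)

lemma weight_mono: "0 \<le> z \<Longrightarrow> z \<le> w \<Longrightarrow> weight z \<le> weight w"
  by (simp add: weight_def power_mono)

text \<open>
  Lowering \<open>r\<close> lowers \<open>ricker r z\<close> and hence its weight, so the bound becomes strict; at the
  critical point \<open>z = 1\<close>, where nothing is gained, the left side is 0.
\<close>

lemma weight_ricker_less:
  assumes "0 < z" "r < 2"
  shows "weight (ricker r z) * \<bar>1 - z\<bar> < weight z"
proof (cases "z = 1")
  case True
  then show ?thesis by (simp add: weight_def)
next
  case False
  have "ricker r z < ricker 2 z"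
    using assms by (simp add: ricker_def)
  then have "weight (ricker r z) < weight (ricker 2 z)"
    using ricker_pos[OF assms(1), of r] by (simp add: weight_def power_strict_mono)
  then have "weight (ricker r z) * \<bar>1 - z\<bar> < weight (ricker 2 z) * \<bar>1 - z\<bar>"
    using False by simp
  then show ?thesis
    using weight_ricker_two_le[OF assms(1)] by linarith
qed

text \<open>
  By monotonicity in \<open>r\<close> only the largest parameter \<open>\<rho>\<close> matters, and for it the quotient of the two
  sides attains a maximum below 1 on the compact interval.
\<close>

lemma uniform_weight_contraction:
  assumes "\<rho> < 2" "0 < \<delta>" "\<delta> \<le> M"
  obtains \<kappa> where "0 \<le> \<kappa>" "\<kappa> < 1"
    "\<And>r z. r \<le> \<rho> \<Longrightarrow> \<delta> \<le> z \<Longrightarrow> z \<le> M \<Longrightarrow> weight (ricker r z) * \<bar>1 - z\<bar> \<le> \<kappa> * weight z"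
proof -
  define q where "q = (\<lambda>z. weight (ricker \<rho> z) * \<bar>1 - z\<bar> / weight z)"
  have "\<exists>t. \<delta> \<le> t \<and> t \<le> M \<and> (\<forall>z. \<delta> \<le> z \<and> z \<le> M \<longrightarrow> q z \<le> q t)"
  proof -
    have "continuous_on {\<delta>..M} q"
    proof -
      have "1 + z ^ 3 / 16 \<noteq> 0" if "z \<in> {\<delta>..M}" for z
        using weight_pos[of z] that assms by (simp add: weight_def)
      then show ?thesis
        unfolding q_def ricker_def weight_def by (auto intro!: continuous_intros)
    qed
    then show ?thesis
      using continuous_attains_sup[of "{\<delta>..M}" q] assms by auto
  qed
  then obtain t where t: "\<delta> \<le> t" "t \<le> M" "\<And>z. \<delta> \<le> z \<Longrightarrow> z \<le> M \<Longrightarrow> q z \<le> q t"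
    by blast
  show ?thesis
  proof
    show "0 \<le> q t"
      using t assms weight_pos[of t] weight_pos[of "ricker \<rho> t"] ricker_pos[of t \<rho>]
      by (simp add: q_def)
    show "q t < 1"
      using t assms weight_pos[of t] weight_ricker_less[of t \<rho>] by (simp add: q_def)
    show "weight (ricker r z) * \<bar>1 - z\<bar> \<le> q t * weight z" if "r \<le> \<rho>" "\<delta> \<le> z" "z \<le> M" for r z
    proof -
      have "0 < z" using that assms by simp
      then have "weight (ricker r z) \<le> weight (ricker \<rho> z)"
        using that ricker_pos[of z r] by (intro weight_mono) (auto simp: ricker_def)
      then have "weight (ricker r z) * \<bar>1 - z\<bar> \<le> weight (ricker \<rho> z) * \<bar>1 - z\<bar>"
        by (intro mult_right_mono) auto
      also have "\<dots> = q z * weight z"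
        using weight_pos[of z] \<open>0 < z\<close> by (simp add: q_def)
      also have "\<dots> \<le> q t * weight z"
        using t(3) that weight_pos[of z] \<open>0 < z\<close> by (intro mult_right_mono) auto
      finally show ?thesis .
    qed
  qed
qed

lemma has_real_derivative_coord:
  assumes "0 < z"
  shows "(coord has_real_derivative weight z / z) (at z)"
  unfolding coord_def weight_def using assms
  by (auto intro!: derivative_eq_intros simp: field_simps power2_eq_square power3_eq_cube)

lemma has_real_derivative_coord_ricker:
  assumes "0 < z"
  shows "((\<lambda>t. coord (ricker r t)) has_real_derivative weight (ricker r z) * (1 - z) / z) (at z)"
proof -
  have "(ricker r has_real_derivative exp (r - z) * (1 - z)) (at z)"
    unfolding ricker_def by (auto intro!: derivative_eq_intros simp: algebra_simps)
  from DERIV_chain2[OF has_real_derivative_coord[OF ricker_pos[OF assms]] this]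
  show ?thesis
    using assms by (simp add: ricker_def mult.commute)
qed

text \<open>
  The derivative bound says that \<open>\<kappa> * coord + coord \<circ> ricker r\<close> and
  \<open>\<kappa> * coord - coord \<circ> ricker r\<close> both have nonnegative derivative; their monotonicity is the
  Lipschitz estimate.
\<close>

lemma coord_ricker_lipschitz:
  assumes "0 < \<delta>" and bd: "\<And>t. \<delta> \<le> t \<Longrightarrow> t \<le> M \<Longrightarrow> weight (ricker r t) * \<bar>1 - t\<bar> \<le> \<kappa> * weight t"
    and "z \<in> {\<delta>..M}" "w \<in> {\<delta>..M}"
  shows "\<bar>coord (ricker r z) - coord (ricker r w)\<bar> \<le> \<kappa> * \<bar>coord z - coord w\<bar>"
proof -
  have mono: "\<bar>coord (ricker r v) - coord (ricker r u)\<bar> \<le> \<kappa> * (coord v - coord u)"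
    if "\<delta> \<le> u" "u \<le> v" "v \<le> M" for u v
  proof -
    \<comment> \<open>The sign \<open>s\<close> treats both combinations at once.\<close>
    have step: "\<kappa> * coord u + s * coord (ricker r u) \<le> \<kappa> * coord v + s * coord (ricker r v)"
      if s: "\<bar>s\<bar> = 1" for s
    proof (rule DERIV_nonneg_imp_nondecreasing[OF \<open>u \<le> v\<close>])
      fix t assume "u \<le> t" "t \<le> v"
      then have t: "\<delta> \<le> t" "t \<le> M" "0 < t"
        using that \<open>\<delta> \<le> u\<close> \<open>v \<le> M\<close> assms by auto
      let ?d = "\<kappa> * (weight t / t) + s * (weight (ricker r t) * (1 - t) / t)"
      have "((\<lambda>t. \<kappa> * coord t + s * coord (ricker r t)) has_real_derivative ?d) (at t)"
        using has_real_derivative_coord[OF t(3)] has_real_derivative_coord_ricker[OF t(3), of r]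
        by (auto intro!: derivative_eq_intros simp: mult_ac)
      moreover have "0 \<le> ?d"
      proof -
        have "\<bar>s * (weight (ricker r t) * (1 - t))\<bar> \<le> \<kappa> * weight t"
          using bd[OF t(1,2)] s weight_pos[of "ricker r t"] ricker_pos[OF t(3), of r]
          by (simp add: abs_mult)
        then have "0 \<le> (\<kappa> * weight t + s * (weight (ricker r t) * (1 - t))) / t"
          using t(3) by (intro divide_nonneg_pos) linarith+
        then show ?thesis
          by (simp add: add_divide_distrib)
      qed
      ultimately show "\<exists>d. ((\<lambda>t. \<kappa> * coord t + s * coord (ricker r t))
          has_real_derivative d) (at t) \<and> 0 \<le> d"
        by blast
    qed
    show ?thesis
      using step[of 1] step[of "-1"] by (simp add: abs_le_iff algebra_simps)
  qed
  have coord_mono: "coord u \<le> coord v" if "\<delta> \<le> u" "u \<le> v" for u v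
    using that assms by (auto simp: coord_def intro!: add_mono divide_right_mono power_mono)
  show ?thesis
  proof (cases "z \<le> w")
    case True
    then show ?thesis
      using mono[of z w] coord_mono[of z w] assms by (simp add: abs_minus_commute)
  next
    case False
    then show ?thesis
      using mono[of w z] coord_mono[of w z] assms by simp
  qed
qed

text \<open>
  Convergence in the new metric implies ordinary convergence, since \<open>coord\<close> increases at least
  as fast as \<open>ln\<close>, whose derivative is at least \<open>1 / M\<close> on \<open>(0, M]\<close>.
\<close>

lemma diff_le_coord_diff:
  assumes "0 < z" "z \<le> M" "0 < w" "w \<le> M"
  shows "\<bar>z - w\<bar> \<le> M * \<bar>coord z - coord w\<bar>"
proof -
  have le: "v - u \<le> M * \<bar>coord v - coord u\<bar>" if "0 < u" "u \<le> v" "v \<le> M" for u v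
  proof -
    have "ln (u / v) \<le> u / v - 1"
      using that by (intro ln_le_minus_one) auto
    then have "1 - u / v \<le> ln v - ln u"
      using that by (simp add: ln_div)
    moreover have "u ^ 3 \<le> v ^ 3"
      using that by (intro power_mono) auto
    ultimately have "1 - u / v \<le> coord v - coord u"
      by (simp add: coord_def)
    then have "v * (1 - u / v) \<le> v * \<bar>coord v - coord u\<bar>"
      using that by (intro mult_left_mono) auto
    also have "\<dots> \<le> M * \<bar>coord v - coord u\<bar>"
      using that by (intro mult_right_mono) auto
    finally show ?thesis
      using that by (simp add: algebra_simps)
  qed
  show ?thesis
    using le[of z w] le[of w z] assms by (cases "z \<le> w") (auto simp: abs_minus_commute)
qed

lemma coord_damp:
  assumes "0 < z" "z \<le> M" "0 \<le> y"
  shows "\<bar>coord (z * exp (- y)) - coord z\<bar> \<le> (1 + M ^ 3 / 16) * y"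
proof -
  have "coord (z * exp (- y)) - coord z = - (y + z ^ 3 / 48 * (1 - exp (- (3 * y))))"
    using assms by (simp add: coord_def ln_mult power_mult_distrib exp_of_nat_mult[symmetric]
        diff_divide_distrib algebra_simps)
  then have "\<bar>coord (z * exp (- y)) - coord z\<bar> = y + z ^ 3 / 48 * (1 - exp (- (3 * y)))"
    using assms by (simp only: abs_minus_cancel)
      (intro abs_of_nonneg add_nonneg_nonneg mult_nonneg_nonneg, auto)
  also have "\<dots> \<le> y + M ^ 3 / 48 * (3 * y)"
    using assms exp_ge_add_one_self[of "- (3 * y)"]
    by (intro add_left_mono mult_mono divide_right_mono power_mono) auto
  finally show ?thesis
    by (simp add: algebra_simps)
qed


section \<open>Periodic sequences and perturbed contractions\<close>

lemma has_period_mod: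
  assumes "has_period m s"
  shows "s n = s (n mod m)"
proof -
  have "s (i + k * m) = s i" for i k
  proof (induction k)
    case (Suc k)
    then show ?case
      using assms unfolding has_period_def by (metis add.assoc add.commute mult_Suc)
  qed simp
  from this[of "n mod m" "n div m"] show ?thesis
    by simp
qed

lemma has_period_bounds:
  assumes "has_period m s"
  obtains k l where "\<And>n. s k \<le> s n" "\<And>n. s n \<le> s l"
proof -
  have m: "0 < m"
    using assms by (simp add: has_period_def)
  have fin: "finite (s ` {..<m})" "s ` {..<m} \<noteq> {}"
    using m by auto
  obtain k where "s k = Min (s ` {..<m})"
    using Min_in[OF fin] by force
  moreover obtain l where "s l = Max (s ` {..<m})"
    using Max_in[OF fin] by force
  moreover have "s n \<in> s ` {..<m}" for n
    using has_period_mod[OF assms, of n] m by simp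
  ultimately show ?thesis
    using that[of k l] fin by simp
qed

text \<open>
  After subtraction of the linear function with the mean of \<open>s\<close> as its slope, the partial sums
  become periodic, hence bounded.
\<close>

lemma periodic_partial_sums_at_top:
  assumes per: "has_period m s" and pos: "0 < (\<Sum>k<m. s k)"
  shows "filterlim (\<lambda>n. \<Sum>k<n. s k) at_top sequentially"
proof -
  define \<mu> where "\<mu> = (\<Sum>k<m. s k) / m"
  define T where "T = (\<lambda>n. (\<Sum>k<n. s k) - \<mu> * n)"
  have m: "0 < m"
    using per by (simp add: has_period_def)
  have "(\<Sum>k<n + m. s k) = (\<Sum>k<n. s k) + (\<Sum>k<m. s k)" for n
    using per by (induction n) (auto simp: has_period_def)
  then have "has_period m T"
    using m by (simp add: has_period_def T_def \<mu>_def field_simps)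
  then obtain k l where "\<And>n. T k \<le> T n"
    using has_period_bounds by blast
  then have "T k + \<mu> * n \<le> (\<Sum>k<n. s k)" for n
    by (simp add: T_def algebra_simps)
  moreover have "filterlim (\<lambda>n. T k + \<mu> * real n) at_top sequentially"
    using pos m
    by (intro filterlim_tendsto_add_at_top[OF tendsto_const]
        filterlim_tendsto_pos_mult_at_top[OF tendsto_const] filterlim_real_sequentially)
      (auto simp: \<mu>_def)
  ultimately show ?thesis
    by (auto intro: filterlim_at_top_mono)
qed

lemma contraction_with_vanishing_error:
  fixes D \<epsilon> :: "nat \<Rightarrow> real"
  assumes \<kappa>: "0 \<le> \<kappa>" "\<kappa> < 1" and D: "\<And>n. 0 \<le> D n" "\<And>n. D (Suc n) \<le> \<kappa> * D n + \<epsilon> n"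
    and \<epsilon>: "\<epsilon> \<longlonglongrightarrow> 0"
  shows "D \<longlonglongrightarrow> 0"
proof (rule LIMSEQ_I)
  fix e :: real assume e: "0 < e"
  then have "0 < (1 - \<kappa>) * (e / 2)"
    using \<kappa> by simp
  from LIMSEQ_D[OF \<epsilon> this] obtain N where N: "\<And>n. n \<ge> N \<Longrightarrow> \<bar>\<epsilon> n\<bar> < (1 - \<kappa>) * (e / 2)"
    by auto
  have bound: "D (N + k) \<le> \<kappa> ^ k * D N + e / 2" for k
  proof (induction k)
    case 0
    then show ?case using e by simp
  next
    case (Suc k)
    have "D (N + Suc k) \<le> \<kappa> * D (N + k) + \<epsilon> (N + k)"
      using D(2)[of "N + k"] by simp
    also have "\<dots> \<le> \<kappa> * (\<kappa> ^ k * D N + e / 2) + (1 - \<kappa>) * (e / 2)"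
      using Suc \<kappa> N[of "N + k"] by (intro add_mono mult_left_mono) auto
    also have "\<dots> = \<kappa> ^ Suc k * D N + e / 2"
      by (simp add: field_simps)
    finally show ?case .
  qed
  have "(\<lambda>k. \<kappa> ^ k * D N) \<longlonglongrightarrow> 0"
    using \<kappa> by (intro tendsto_mult_left_zero LIMSEQ_power_zero) auto
  from LIMSEQ_D[OF this, of "e / 2"] e obtain K where K: "\<And>k. k \<ge> K \<Longrightarrow> \<bar>\<kappa> ^ k * D N\<bar> < e / 2"
    by auto
  have "norm (D n - 0) < e" if "n \<ge> N + K" for n
  proof -
    have "K \<le> n - N" "N + (n - N) = n"
      using that by auto
    then show ?thesis
      using bound[of "n - N"] K[of "n - N"] D(1)[of n] by (auto simp: abs_less_iff)
  qed
  then show "\<exists>no. \<forall>n\<ge>no. norm (D n - 0) < e"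
    by blast
qed

lemma tendsto_zero_even_odd:
  fixes f :: "nat \<Rightarrow> real"
  assumes "(\<lambda>n. f (2 * n)) \<longlonglongrightarrow> 0" "(\<lambda>n. f (2 * n + 1)) \<longlonglongrightarrow> 0"
  shows "f \<longlonglongrightarrow> 0"
proof (rule LIMSEQ_I)
  fix e :: real assume "0 < e"
  with LIMSEQ_D[OF assms(1)] LIMSEQ_D[OF assms(2)] obtain N K where
    N: "\<And>n. n \<ge> N \<Longrightarrow> norm (f (2 * n) - 0) < e" and K: "\<And>n. n \<ge> K \<Longrightarrow> norm (f (2 * n + 1) - 0) < e"
    by metis
  have "norm (f n - 0) < e" if "n \<ge> 2 * (N + K) + 1" for n
  proof (cases "even n")
    case True
    then show ?thesis using N[of "n div 2"] that by simp
  next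
    case False
    then show ?thesis using K[of "n div 2"] that by simp
  qed
  then show "\<exists>no. \<forall>n\<ge>no. norm (f n - 0) < e"
    by blast
qed

section \<open>Orbits of periodic Ricker recursions\<close>

text \<open>
  The distance of the orbits in the contracted metric shrinks by a fixed factor in each step, up to
  an error proportional to the damping \<open>y n\<close>.
\<close>

lemma damped_ricker_tracking:
  assumes z: "\<And>n. z (Suc n) = ricker (r n) (z n) * exp (- y n)" "\<And>n. z n \<in> {\<delta>..M}"
    and w: "\<And>n. w (Suc n) = ricker (r n) (w n)" "\<And>n. w n \<in> {\<delta>..M}"
    and r: "\<And>n. r n \<le> \<rho>" "\<rho> < 2"
    and M: "0 < \<delta>" "exp 1 \<le> M"
    and y: "\<And>n. 0 \<le> y n" "y \<longlonglongrightarrow> 0"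
  shows "(\<lambda>n. \<bar>z n - w n\<bar>) \<longlonglongrightarrow> 0"
proof -
  have "\<delta> \<le> M"
    using z(2)[of 0] by simp
  from uniform_weight_contraction[OF r(2) M(1) this] obtain \<kappa> where \<kappa>: "0 \<le> \<kappa>" "\<kappa> < 1"
    and contr: "\<And>r z. r \<le> \<rho> \<Longrightarrow> \<delta> \<le> z \<Longrightarrow> z \<le> M \<Longrightarrow>
                  weight (ricker r z) * \<bar>1 - z\<bar> \<le> \<kappa> * weight z"
    by blast
  define D where "D = (\<lambda>n. \<bar>coord (z n) - coord (w n)\<bar>)"
  have "D \<longlonglongrightarrow> 0"
  proof (rule contraction_with_vanishing_error[OF \<kappa>])
    show "D (Suc n) \<le> \<kappa> * D n + (1 + M ^ 3 / 16) * y n" for n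
    proof -
      have "0 < z n"
        using z(2)[of n] M by simp
      have "exp (r n - 1) \<le> exp 1"
        using r(1)[of n] r(2) by simp
      then have "ricker (r n) (z n) \<le> M"
        using ricker_le_peak[of "r n" "z n"] M(2) by linarith
      then have "\<bar>coord (z (Suc n)) - coord (ricker (r n) (z n))\<bar> \<le> (1 + M ^ 3 / 16) * y n"
        unfolding z(1) using ricker_pos[OF \<open>0 < z n\<close>] y(1) by (intro coord_damp) auto
      moreover have "\<bar>coord (ricker (r n) (z n)) - coord (w (Suc n))\<bar> \<le> \<kappa> * D n"
        unfolding w(1) D_def using M(1) contr[OF r(1)] z(2) w(2)
        by (intro coord_ricker_lipschitz) auto
      ultimately show ?thesis
        unfolding D_def by linarith
    qed
    show "(\<lambda>n. (1 + M ^ 3 / 16) * y n) \<longlonglongrightarrow> 0"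
      using y(2) by (rule tendsto_mult_right_zero)
  qed (simp add: D_def)
  then have lim: "(\<lambda>n. M * D n) \<longlonglongrightarrow> 0"
    by (rule tendsto_mult_right_zero)
  have "\<bar>z n - w n\<bar> \<le> M * D n" for n
    unfolding D_def using z(2)[of n] w(2)[of n] M by (intro diff_le_coord_diff) auto
  then show ?thesis
    by (intro tendsto_sandwich[OF _ _ tendsto_const lim]) auto
qed

lemma ricker_orbit_bounded_below:
  assumes "\<And>n. w (Suc n) = ricker (r n) (w n)" "\<And>n. \<alpha> \<le> r n" "\<And>n. w n \<le> M" "0 < \<alpha>" "0 < w 0"
  shows "min (w 0) (\<alpha> * exp (- M)) \<le> w n"
proof (induction n)
  case (Suc n)
  show ?case
    unfolding assms(1)[of n] using assms Suc by (intro ricker_bounded_below[of \<alpha> _ _ M]) auto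
qed simp

fun ricker_orbit :: "(nat \<Rightarrow> real) \<Rightarrow> real \<Rightarrow> nat \<Rightarrow> real" where
  "ricker_orbit r z 0 = z"
| "ricker_orbit r z (Suc n) = ricker (r n) (ricker_orbit r z n)"

lemma continuous_on_ricker_orbit: "continuous_on A (\<lambda>z. ricker_orbit r z n)"
  by (induction n) (auto simp: ricker_def intro!: continuous_intros)

text \<open>
  The map over one period is continuous and sends the interval \<open>[\<delta>, e]\<close> into itself, hence has
  a fixed point by the intermediate value theorem.  The upper end is the largest value that a
  Ricker map with \<open>r \<le> 2\<close> attains, the lower end is the barrier of \<open>ricker_bounded_below\<close>.
\<close>

lemma periodic_ricker_orbit_exists:
  assumes per: "has_period m r" and r: "\<And>n. 0 < r n" "\<And>n. r n < 2"
  obtains w where "has_period m w" "\<And>n. 0 < w n" "\<And>n. w (Suc n) = ricker (r n) (w n)"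
proof -
  have m: "0 < m"
    using per by (simp add: has_period_def)
  obtain k where \<alpha>: "\<And>n. r k \<le> r n"
    using has_period_bounds[OF per] by metis
  define \<delta> where "\<delta> = r k * exp (- exp 1)"
  have \<delta>: "0 < \<delta>"
    using r by (simp add: \<delta>_def)
  \<comment> \<open>The interval is nonempty, because \<open>\<delta> \<le> 1\<close>.\<close>
  have "\<delta> \<le> 2 * (1 / 2)"
  proof -
    have "exp (- exp 1) \<le> exp (- 1 :: real)"
      using exp_ge_add_one_self[of 1] by simp
    also have "\<dots> \<le> 1 / 2"
      using exp_ge_add_one_self[of 1] by (simp add: exp_minus field_simps)
    finally show ?thesis
      unfolding \<delta>_def using r[of k] by (intro mult_mono) auto
  qed
  then have \<delta>M: "\<delta> \<le> exp 1"
    using exp_ge_add_one_self[of 1] by simp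
  have inv: "ricker_orbit r z n \<in> {\<delta>..exp 1}" if "z \<in> {\<delta>..exp 1}" for z n
  proof (induction n)
    case 0
    then show ?case using that by simp
  next
    case (Suc n)
    have "exp (r n - 1) \<le> exp 1"
      using r(2)[of n] by simp
    then have "ricker (r n) (ricker_orbit r z n) \<le> exp 1"
      using ricker_le_peak order.trans by blast
    moreover have "\<delta> \<le> ricker (r n) (ricker_orbit r z n)"
      using Suc \<delta> r \<alpha> by (intro ricker_bounded_below[of "r k" _ _ "exp 1"]) (auto simp: \<delta>_def)
    ultimately show ?case
      by simp
  qed
  have "\<exists>z. \<delta> \<le> z \<and> z \<le> exp 1 \<and> z - ricker_orbit r z m = 0"
    using inv[of \<delta> m] inv[of "exp 1" m] \<delta>M
    by (intro IVT' continuous_intros continuous_on_ricker_orbit) auto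
  then obtain z where z: "z \<in> {\<delta>..exp 1}" "ricker_orbit r z m = z"
    by auto
  show ?thesis
  proof
    have "ricker_orbit r z (n + m) = ricker_orbit r z n" for n
      using per z(2) by (induction n) (auto simp: has_period_def)
    then show "has_period m (ricker_orbit r z)"
      using m by (simp add: has_period_def)
    show "0 < ricker_orbit r z n" for n
      using inv[OF z(1), of n] \<delta> by simp
  qed simp
qed

text \<open>
  The increments of \<open>ln (w n)\<close> are \<open>r n - w n\<close>, and they add up to 0 over one period.
\<close>

lemma periodic_ricker_orbit_sum:
  assumes "has_period m w" "\<And>n. 0 < w n" "\<And>n. w (Suc n) = ricker (r n) (w n)"
  shows "(\<Sum>k<m. w k) = (\<Sum>k<m. r k)"
proof -
  have "ln (w (Suc n)) - ln (w n) = r n - w n" for n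
    using assms(2)[of n] by (simp add: assms(3) ricker_def ln_mult)
  then have "(\<Sum>k<m. r k - w k) = ln (w m) - ln (w 0)"
    using sum_lessThan_telescope[of "\<lambda>n. ln (w n)" m] by simp
  also have "w m = w 0"
    using assms(1) unfolding has_period_def by (metis add_0)
  finally show ?thesis
    by (simp add: sum_subtractf)
qed

section \<open>The two competitors\<close>

text \<open>
  In \<open>L = ln y - y - ln z\<close> the summand \<open>- y\<close> compensates for \<open>z\<close> being updated with the new value
  \<open>y (Suc n)\<close> instead of \<open>y n\<close>: the interaction terms cancel, and \<open>L\<close> changes by \<open>c n - b n\<close>.
\<close>

lemma weaker_competitor_vanishes:
  fixes y z b c :: "nat \<Rightarrow> real"
  assumes pos: "\<And>n. 0 < y n" "\<And>n. 0 < z n"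
    and y: "\<And>n. y (Suc n) = y n * exp (c n - y n - z n)"
    and z: "\<And>n. z (Suc n) = z n * exp (b n - z n - y (Suc n))"
    and per: "has_period m b" "has_period m c"
    and less: "(\<Sum>k<m. c k) < (\<Sum>k<m. b k)"
  shows "y \<longlonglongrightarrow> 0"
proof -
  obtain i where B: "\<And>n. b n \<le> b i"
    using has_period_bounds[OF per(1)] by metis
  obtain j where C: "\<And>n. c n \<le> c j"
    using has_period_bounds[OF per(2)] by metis
  define L where "L = (\<lambda>n. ln (y n) - y n - ln (z n))"
  have "ln (y (Suc n)) = ln (y n) + c n - y n - z n" for n
    using pos(1)[of n] by (subst y) (simp add: ln_mult)
  moreover have "ln (z (Suc n)) = ln (z n) + b n - z n - y (Suc n)" for n
    using pos(2)[of n] by (subst z) (simp add: ln_mult)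
  ultimately have L_step: "L (Suc n) = L n - (b n - c n)" for n
    by (simp add: L_def)
  define L0 where "L0 = L 0"
  have L: "L n = L0 - (\<Sum>k<n. b k - c k)" for n
    by (induction n) (auto simp: L_step L0_def)
  have "filterlim (\<lambda>n. \<Sum>k<n. b k - c k) at_top sequentially"
    using per less by (intro periodic_partial_sums_at_top[of m]) (auto simp: has_period_def sum_subtractf)
  then have "filterlim (\<lambda>n. - L0 + (\<Sum>k<n. b k - c k)) at_top sequentially"
    by (intro filterlim_tendsto_add_at_top[OF tendsto_const])
  then have "filterlim (\<lambda>n. - L n) at_top sequentially"
    by (simp add: L)
  then have "(\<lambda>n. exp (L n)) \<longlonglongrightarrow> 0"
    by (intro filterlim_compose[OF exp_at_bot]) (simp add: filterlim_uminus_at_bot)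
  then have lim: "(\<lambda>n. exp (b i - 1) * exp (exp (c j - 1)) * exp (L (Suc n))) \<longlonglongrightarrow> 0"
    by (intro tendsto_mult_right_zero) (rule LIMSEQ_Suc)
  have "y (Suc n) \<le> exp (b i - 1) * exp (exp (c j - 1)) * exp (L (Suc n))" for n
  proof -
    have "z (Suc n) \<le> ricker (b n - y (Suc n)) (z n)"
      by (subst z) (simp add: ricker_def algebra_simps)
    also have "\<dots> \<le> exp (b n - y (Suc n) - 1)"
      by (rule ricker_le_peak)
    also have "\<dots> \<le> exp (b i - 1)"
      using B[of n] pos(1)[of "Suc n"] by simp
    finally have z_le: "z (Suc n) \<le> exp (b i - 1)" .
    have "y (Suc n) \<le> ricker (c n - z n) (y n)"
      by (subst y) (simp add: ricker_def algebra_simps)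
    also have "\<dots> \<le> exp (c n - z n - 1)"
      by (rule ricker_le_peak)
    also have "\<dots> \<le> exp (c j - 1)"
      using C[of n] pos(2)[of n] by simp
    finally have y_le: "y (Suc n) \<le> exp (c j - 1)" .
    have "y (Suc n) = z (Suc n) * exp (y (Suc n)) * exp (L (Suc n))"
      using pos(1)[of "Suc n"] pos(2)[of "Suc n"] by (simp add: L_def exp_diff)
    also have "\<dots> \<le> exp (b i - 1) * exp (exp (c j - 1)) * exp (L (Suc n))"
      using z_le y_le pos(2)[of "Suc n"] by (intro mult_right_mono mult_mono) auto
    finally show ?thesis .
  qed
  then have "(\<lambda>n. y (Suc n)) \<longlonglongrightarrow> 0"
    using lim less_imp_le[OF pos(1)] by (intro tendsto_sandwich[OF _ _ tendsto_const lim]) auto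
  then show ?thesis
    by (rule LIMSEQ_imp_Suc)
qed

text \<open>
  From some index \<open>N\<close> on, \<open>y\<close> is so small that \<open>z\<close> behaves like an orbit of Ricker maps with
  parameters at least \<open>\<alpha> > 0\<close>.  Then \<open>z\<close> and \<open>w\<close> stay in a common compact interval of positive
  numbers, in which the contraction applies.
\<close>

lemma stronger_competitor_tracks:
  fixes y z b w :: "nat \<Rightarrow> real"
  assumes y: "\<And>n. 0 < y n" "y \<longlonglongrightarrow> 0"
    and z: "\<And>n. 0 < z n" "\<And>n. z (Suc n) = z n * exp (b n - z n - y (Suc n))"
    and w: "\<And>n. 0 < w n" "\<And>n. w (Suc n) = ricker (b n) (w n)"
    and b: "has_period m b" "\<And>n. 0 < b n" "\<And>n. b n < 2"
  shows "(\<lambda>n. \<bar>z n - w n\<bar>) \<longlonglongrightarrow> 0"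
proof -
  obtain k where k: "\<And>n. b k \<le> b n"
    using has_period_bounds[OF b(1)] by metis
  obtain l where l: "\<And>n. b n \<le> b l"
    using has_period_bounds[OF b(1)] by metis
  define \<alpha> where "\<alpha> = b k / 2"
  have \<alpha>: "0 < \<alpha>"
    using b(2) by (simp add: \<alpha>_def)
  obtain N0 where N0: "\<And>n. n \<ge> N0 \<Longrightarrow> y n < \<alpha>"
    using LIMSEQ_D[OF y(2) \<alpha>] y(1) by (metis abs_of_pos diff_zero real_norm_def)
  \<comment> \<open>One step later \<open>z\<close> and \<open>w\<close> are values of Ricker maps, hence at most \<open>e\<close>.\<close>
  define N where "N = Suc N0"
  have z_ricker: "z (Suc n) = ricker (b n - y (Suc n)) (z n)" for n
    by (simp add: z(2) ricker_def algebra_simps)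
  have upper: "ricker r t \<le> exp 1" if "r < 2" for r t
    using that by (intro order.trans[OF ricker_le_peak]) simp
  have z_le: "z (N + n) \<le> exp 1" for n
    using upper[of "b (N0 + n) - y (Suc (N0 + n))"] b(3)[of "N0 + n"] y(1)[of "Suc (N0 + n)"]
    by (simp add: N_def z_ricker)
  have w_le: "w (N + n) \<le> exp 1" for n
    using upper b(3) by (simp add: N_def w(2))
  define \<delta> where "\<delta> = min (min (z N) (w N)) (\<alpha> * exp (- exp 1))"
  have z_ge: "min (z (N + 0)) (\<alpha> * exp (- exp 1)) \<le> z (N + n)" for n
  proof (rule ricker_orbit_bounded_below[where w = "\<lambda>n. z (N + n)"])
    show "z (N + Suc n) = ricker (b (N + n) - y (Suc (N + n))) (z (N + n))" for n
      using z_ricker by simp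
    show "\<alpha> \<le> b (N + n) - y (Suc (N + n))" for n
      using k[of "N + n"] N0[of "Suc (N + n)"] by (simp add: N_def \<alpha>_def)
  qed (use z_le z(1) \<alpha> in auto)
  have w_ge: "min (w (N + 0)) (\<alpha> * exp (- exp 1)) \<le> w (N + n)" for n
  proof (rule ricker_orbit_bounded_below[where w = "\<lambda>n. w (N + n)"])
    show "w (N + Suc n) = ricker (b (N + n)) (w (N + n))" for n
      using w(2) by simp
    show "\<alpha> \<le> b (N + n)" for n
      using k[of "N + n"] \<alpha> by (simp add: \<alpha>_def)
  qed (use w_le w(1) \<alpha> in auto)
  have "(\<lambda>n. \<bar>z (N + n) - w (N + n)\<bar>) \<longlonglongrightarrow> 0"
  proof (rule damped_ricker_tracking)
    show "z (N + Suc n) = ricker (b (N + n)) (z (N + n)) * exp (- y (Suc (N + n)))" for n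
      by (simp add: z(2) ricker_def exp_add[symmetric] mult.assoc)
    show "z (N + n) \<in> {\<delta>..exp 1}" for n
      using z_ge[of n] z_le[of n] by (auto simp: \<delta>_def)
    show "w (N + n) \<in> {\<delta>..exp 1}" for n
      using w_ge[of n] w_le[of n] by (auto simp: \<delta>_def)
    show "0 < \<delta>"
      using z(1) w(1) \<alpha> by (simp add: \<delta>_def)
    show "(\<lambda>n. y (Suc (N + n))) \<longlonglongrightarrow> 0"
      using LIMSEQ_ignore_initial_segment[OF y(2), of "Suc N"] by (simp add: add_ac)
    show "w (N + Suc n) = ricker (b (N + n)) (w (N + n))" for n
      using w(2) by simp
    show "0 \<le> y (Suc (N + n))" for n
      using y(1) less_imp_le by blast
    show "b (N + n) \<le> b l" "b l < 2" "exp 1 \<le> exp (1::real)" for n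
      using l b(3) by auto
  qed
  then show ?thesis
    using LIMSEQ_offset[of "\<lambda>n. \<bar>z n - w n\<bar>" N] by (simp add: add.commute)
qed

section \<open>The periodic attractor\<close>

lemma sum_alternating_even_length:
  fixes a :: "nat \<Rightarrow> real"
  shows "(\<Sum>j=1..2 * m. (-1) ^ j * a (j - 1)) = (\<Sum>k<m. a (2 * k + 1)) - (\<Sum>k<m. a (2 * k))"
  by (induction m) auto

text \<open>
  If \<open>\<sigma> > 0\<close>, the terms with odd index die out, so the attractor carries the periodic Ricker
  orbit on the even indices and is 0 on the odd ones.
\<close>

lemma even_terms_survive:
  fixes a :: "nat \<Rightarrow> real" and p :: nat
  assumes per: "has_period p a" and "even p"
    and \<sigma>: "0 < (\<Sum>j=1..p. (-1) ^ j * a (j - 1))"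
    and range: "\<forall>k\<in>{1..p div 2}. 0 < a (2 * k - 1) \<and> a (2 * k - 1) < 2"
  shows "\<exists>xbar. periodic_solution a p xbar \<and> globally_attracting a xbar \<and>
              (\<forall>n::nat. xbar (2 * int n - 1) = 0) \<and>
              has_period (p div 2) (\<lambda>n. xbar (2 * int n)) \<and>
              (\<Sum>i=1..p div 2. xbar (2 * int i - 2)) = (\<Sum>i=1..p div 2. a (2 * i - 1))"
proof -
  define m where "m = p div 2"
  have p: "p = 2 * m"
    using \<open>even p\<close> by (simp add: m_def)
  define b where "b = (\<lambda>n. a (2 * n + 1))"
  define c where "c = (\<lambda>n. a (2 * n))"
  have m: "0 < m"
    using per p by (simp add: has_period_def)
  have ap: "a (n + 2 * m) = a n" for n
    using per p by (simp add: has_period_def)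
  have bc: "has_period m b" "has_period m c"
  proof -
    have "a (2 * (n + m) + 1) = a (2 * n + 1)" "a (2 * (n + m)) = a (2 * n)" for n
      using ap[of "2 * n + 1"] ap[of "2 * n"] by (simp_all add: add_ac distrib_left)
    then show "has_period m b" "has_period m c"
      using m by (simp_all add: has_period_def b_def c_def)
  qed
  have b: "0 < b n" "b n < 2" for n
  proof -
    have "0 < b k \<and> b k < 2" if "k < m" for k
      using range[rule_format, of "Suc k"] that by (simp add: b_def m_def)
    then show "0 < b n" "b n < 2"
      using m has_period_mod[OF bc(1), of n] by (metis mod_less_divisor)+
  qed
  have cb: "(\<Sum>k<m. c k) < (\<Sum>k<m. b k)"
    using \<sigma> unfolding p sum_alternating_even_length by (simp add: b_def c_def)
  obtain w where w: "has_period m w" "\<And>n. 0 < w n" "\<And>n. w (Suc n) = ricker (b n) (w n)"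
    using periodic_ricker_orbit_exists[OF bc(1) b] by blast
  define xbar where "xbar = (\<lambda>i::int. if even i then w (nat (i div 2)) else 0)"
  have xbar_even: "xbar (2 * int n) = w n" for n
    by (simp add: xbar_def)
  have xbar_odd: "xbar (2 * i - 1) = 0" for i
    by (simp add: xbar_def)
  have "is_solution a xbar"
    unfolding is_solution_def
  proof
    fix n :: nat
    show "xbar (int n + 1) = xbar (int n - 1) * exp (a n - xbar (int n - 1) - xbar (int n))"
    proof (cases "even n")
      case True
      then show ?thesis by (simp add: xbar_def)
    next
      case False
      then obtain k where k: "n = 2 * k + 1"
        using oddE by blast
      have "int n + 1 = 2 * int (Suc k)" "int n - 1 = 2 * int k" "int n = 2 * int (Suc k) - 1"
        using k by auto
      then show ?thesis
        unfolding \<open>int n + 1 = 2 * int (Suc k)\<close> \<open>int n - 1 = 2 * int k\<close> xbar_even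
        using w(3)[of k] xbar_odd[of "int (Suc k)"] k
        by (simp add: ricker_def b_def)
    qed
  qed
  moreover have "has_period p (\<lambda>n. xbar (int n - 1))"
    unfolding has_period_def
  proof (intro conjI allI)
    fix n :: nat
    show "xbar (int (n + p) - 1) = xbar (int n - 1)"
    proof (cases "even n")
      case True
      then show ?thesis by (simp add: xbar_def p)
    next
      case False
      then obtain k where "n = 2 * k + 1"
        using oddE by blast
      then have "int (n + p) - 1 = 2 * int (k + m)" "int n - 1 = 2 * int k"
        using p by auto
      then show ?thesis
        using w(1) by (simp only: xbar_even has_period_def)
    qed
  qed (use m p in simp)
  moreover have "globally_attracting a xbar"
    unfolding globally_attracting_def
  proof (intro allI impI)
    fix x :: "int \<Rightarrow> real"
    assume x: "is_solution a x \<and> 0 < x (-1) \<and> 0 < x 0"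
    define y where "y = (\<lambda>n::nat. x (2 * int n - 1))"
    define z where "z = (\<lambda>n::nat. x (2 * int n))"
    have rec: "x (int n + 1) = x (int n - 1) * exp (a n - x (int n - 1) - x (int n))" for n
      using x by (simp add: is_solution_def)
    have y: "y (Suc n) = y n * exp (c n - y n - z n)" for n
      using rec[of "2 * n"] by (simp add: y_def z_def c_def add_ac)
    have z: "z (Suc n) = z n * exp (b n - z n - y (Suc n))" for n
      using rec[of "2 * n + 1"] by (simp add: y_def z_def b_def add_ac diff_diff_eq)
    have pos: "0 < y n \<and> 0 < z n" for n
      by (induction n) (use x y z in \<open>auto simp: y_def z_def\<close>)
    have ylim: "y \<longlonglongrightarrow> 0"
      using weaker_competitor_vanishes[OF _ _ y z bc cb] pos by blast
    have zlim: "(\<lambda>n. \<bar>z n - w n\<bar>) \<longlonglongrightarrow> 0"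
      using stronger_competitor_tracks[OF _ ylim _ z w(2,3) bc(1) b] pos by blast
    show "(\<lambda>n. \<bar>x (int n) - xbar (int n)\<bar>) \<longlonglongrightarrow> 0"
    proof (rule tendsto_zero_even_odd)
      show "(\<lambda>n. \<bar>x (int (2 * n)) - xbar (int (2 * n))\<bar>) \<longlonglongrightarrow> 0"
        using zlim by (simp add: z_def xbar_even)
      have "\<bar>x (int (2 * n + 1)) - xbar (int (2 * n + 1))\<bar> = y (Suc n)" for n
        using pos[of "Suc n"] by (simp add: y_def xbar_def)
      then show "(\<lambda>n. \<bar>x (int (2 * n + 1)) - xbar (int (2 * n + 1))\<bar>) \<longlonglongrightarrow> 0"
        using LIMSEQ_Suc[OF ylim] by simp
    qed
  qed
  moreover have "(\<Sum>i=1..m. xbar (2 * int i - 2)) = (\<Sum>i=1..m. a (2 * i - 1))"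
  proof -
    have shift: "(\<Sum>i=1..m. f i) = (\<Sum>k<m. f (Suc k))" for f :: "nat \<Rightarrow> real"
      by (simp add: sum.atLeast1_atMost_eq)
    have "xbar (2 * int (Suc k) - 2) = w k" for k
      using xbar_even[of k] by simp
    then show ?thesis
      using periodic_ricker_orbit_sum[OF w] unfolding shift by (simp add: b_def)
  qed
  ultimately show ?thesis
    using w(1) xbar_odd by (intro exI[of _ xbar]) (simp add: periodic_solution_def xbar_even m_def)
qed

lemma is_solution_shift:
  "is_solution a x \<Longrightarrow> is_solution (\<lambda>n. a (Suc n)) (\<lambda>i. x (i + 1))"
  unfolding is_solution_def
proof
  fix n assume "\<forall>n::nat. x (int n + 1) = x (int n - 1) * exp (a n - x (int n - 1) - x (int n))"
  from this[rule_format, of "Suc n"]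
  show "x (int n + 1 + 1) = x (int n - 1 + 1) * exp (a (Suc n) - x (int n - 1 + 1) - x (int n + 1))"
    by (simp add: add_ac)
qed

theorem theorem18:
  fixes a :: "nat \<Rightarrow> real" and p :: nat and \<sigma> :: real
  assumes "minimal_period p a" and "even p" and "p \<ge> 2"
    and "\<sigma> = (\<Sum>j=1..p. (-1) ^ j * a (j - 1))"
  shows "(\<sigma> > 0 \<and> (\<forall>k\<in>{1..p div 2}. 0 < a (2 * k - 1) \<and> a (2 * k - 1) < 2) \<longrightarrow>
           (\<exists>xbar. periodic_solution a p xbar \<and> globally_attracting a xbar \<and>
              (\<forall>n::nat. xbar (2 * int n - 1) = 0) \<and>
              has_period (p div 2) (\<lambda>n. xbar (2 * int n)) \<and>
              (\<Sum>i=1..p div 2. xbar (2 * int i - 2)) = (\<Sum>i=1..p div 2. a (2 * i - 1)))) \<and>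
         (\<sigma> < 0 \<and> (\<forall>k\<in>{1..p div 2}. 0 < a (2 * k - 2) \<and> a (2 * k - 2) < 2) \<longrightarrow>
           (\<exists>xbar. periodic_solution a p xbar \<and> globally_attracting a xbar \<and>
              (\<forall>n::nat. xbar (2 * int n) = 0) \<and>
              has_period (p div 2) (\<lambda>n. xbar (2 * int n - 1)) \<and>
              (\<Sum>i=1..p div 2. xbar (2 * int i - 1)) = (\<Sum>i=1..p div 2. a (2 * i - 2))))"
  (is "?A \<and> ?B")
proof
  have per: "has_period p a"
    using assms(1) by (simp add: minimal_period_def)
  show ?A
    using even_terms_survive[OF per \<open>even p\<close>] assms(4) by blast
  show ?B
  proof
    assume B: "\<sigma> < 0 \<and> (\<forall>k\<in>{1..p div 2}. 0 < a (2 * k - 2) \<and> a (2 * k - 2) < 2)"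
    define m where "m = p div 2"
    have p: "p = 2 * m" and m: "0 < m"
      using \<open>even p\<close> \<open>p \<ge> 2\<close> by (auto simp: m_def)
    define a' where "a' = (\<lambda>n. a (Suc n))"
    have ap: "a (n + 2 * m) = a n" for n
      using per p by (simp add: has_period_def)
    have per': "has_period p a'"
      using per unfolding has_period_def a'_def by (metis add_Suc)
    have rotate: "(\<Sum>k<m. a (2 * k + 2)) = (\<Sum>k<m. a (2 * k))"
      using sum.lessThan_Suc_shift[of "\<lambda>k. a (2 * k)" m] ap[of 0] by simp
    have "(\<Sum>j=1..p. (-1) ^ j * a' (j - 1)) = - \<sigma>"
      using rotate unfolding assms(4) p sum_alternating_even_length by (simp add: a'_def)
    then have \<sigma>': "0 < (\<Sum>j=1..p. (-1) ^ j * a' (j - 1))"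
      using B by simp
    have range': "\<forall>k\<in>{1..p div 2}. 0 < a' (2 * k - 1) \<and> a' (2 * k - 1) < 2"
    proof
      fix k assume k: "k \<in> {1..p div 2}"
      show "0 < a' (2 * k - 1) \<and> a' (2 * k - 1) < 2"
      proof (cases "k = m")
        case True
        then have "a' (2 * k - 1) = a (2 * 1 - 2)"
          using ap[of 0] m by (simp add: a'_def)
        then show ?thesis
          using B[THEN conjunct2, rule_format, of 1] m by (simp add: m_def)
      next
        case False
        then have "a' (2 * k - 1) = a (2 * Suc k - 2)"
          using k by (simp add: a'_def)
        then show ?thesis
          using B[THEN conjunct2, rule_format, of "Suc k"] k False by (simp add: m_def)
      qed
    qed
    obtain x' where x': "periodic_solution a' p x'" "globally_attracting a' x'"
      "\<And>n::nat. x' (2 * int n - 1) = 0" "has_period m (\<lambda>n. x' (2 * int n))"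
      "(\<Sum>i=1..m. x' (2 * int i - 2)) = (\<Sum>i=1..m. a' (2 * i - 1))"
      using even_terms_survive[OF per' \<open>even p\<close> \<sigma>' range'] m_def by blast
    have x'_per: "x' (int n - 1 + int p) = x' (int n - 1)" for n
      using x'(1) unfolding periodic_solution_def has_period_def
      by (metis add_diff_eq diff_add_eq of_nat_add)
    \<comment> \<open>Undoing the shift at index \<open>-1\<close> would need \<open>x'\<close> at \<open>-2\<close>, where \<open>x'\<close> is unconstrained;
      adding a period avoids this.\<close>
    define xbar where "xbar = (\<lambda>i. x' (i - 1 + int p))"
    have xbar_eq: "xbar (int n) = x' (int n - 1)" for n
      using x'_per by (simp add: xbar_def)
    show "\<exists>xbar. periodic_solution a p xbar \<and> globally_attracting a xbar \<and>
              (\<forall>n::nat. xbar (2 * int n) = 0) \<and>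
              has_period (p div 2) (\<lambda>n. xbar (2 * int n - 1)) \<and>
              (\<Sum>i=1..p div 2. xbar (2 * int i - 1)) = (\<Sum>i=1..p div 2. a (2 * i - 2))"
    proof (intro exI conjI allI)
      show "periodic_solution a p xbar"
        unfolding periodic_solution_def
      proof
        show "is_solution a xbar"
          unfolding is_solution_def
        proof
          fix n :: nat
          define j where "j = n + p - 1"
          have j: "xbar (int n + 1) = x' (int j + 1)" "xbar (int n - 1) = x' (int j - 1)"
            "xbar (int n) = x' (int j)" "a n = a' j"
            using \<open>p \<ge> 2\<close> per
            by (auto simp: xbar_def j_def a'_def has_period_def of_nat_diff algebra_simps)
          show "xbar (int n + 1) = xbar (int n - 1) * exp (a n - xbar (int n - 1) - xbar (int n))"
            unfolding j using x'(1) by (simp add: periodic_solution_def is_solution_def)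
        qed
        have "xbar (int n - 1 + int p) = xbar (int n - 1)" for n
          using x'_per[of "n + p - 1"] \<open>p \<ge> 2\<close>
          by (simp add: xbar_def of_nat_diff algebra_simps)
        then show "has_period p (\<lambda>n. xbar (int n - 1))"
          using \<open>p \<ge> 2\<close> by (simp add: has_period_def algebra_simps)
      qed
      show "globally_attracting a xbar"
        unfolding globally_attracting_def
      proof (intro allI impI)
        fix x assume x: "is_solution a x \<and> 0 < x (-1) \<and> 0 < x 0"
        then have "x (int 0 + 1) = x (int 0 - 1) * exp (a 0 - x (int 0 - 1) - x (int 0))"
          by (simp only: is_solution_def)
        then have "0 < x 1"
          using x by simp
        then have "(\<lambda>n. \<bar>x (int n + 1) - x' (int n)\<bar>) \<longlonglongrightarrow> 0"
          using x'(2) is_solution_shift[of a x] x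
          unfolding globally_attracting_def a'_def by (auto dest: spec[of _ "\<lambda>i. x (i + 1)"])
        then have "(\<lambda>n. \<bar>x (int (Suc n)) - xbar (int (Suc n))\<bar>) \<longlonglongrightarrow> 0"
          unfolding xbar_eq by (simp add: add.commute)
        then show "(\<lambda>n. \<bar>x (int n) - xbar (int n)\<bar>) \<longlonglongrightarrow> 0"
          by (rule LIMSEQ_imp_Suc)
      qed
      show "xbar (2 * int n) = 0" for n
        using xbar_eq[of "2 * n"] x'(3)[of n] by simp
      have xbar_odd: "xbar (2 * int n - 1) = x' (2 * int (n + m - 1))" for n
        using m by (simp add: xbar_def p of_nat_diff algebra_simps)
      have "x' (2 * int (n + m - 1 + m)) = x' (2 * int (n + m - 1))" for n
        using x'(4) by (simp only: has_period_def)
      then show "has_period (p div 2) (\<lambda>n. xbar (2 * int n - 1))"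
        using m unfolding has_period_def xbar_odd m_def[symmetric] by (simp add: algebra_simps)
      have "xbar (2 * int i - 1) = x' (2 * int i - 2)" if "i \<in> {1..m}" for i
        using that xbar_eq[of "2 * i - 1"] by (simp add: of_nat_diff)
      then have "(\<Sum>i=1..m. xbar (2 * int i - 1)) = (\<Sum>i=1..m. a' (2 * i - 1))"
        using x'(5) by simp
      also have "\<dots> = (\<Sum>k<m. a (2 * k + 2))"
        by (simp add: sum.atLeast1_atMost_eq a'_def)
      also have "\<dots> = (\<Sum>i=1..m. a (2 * i - 2))"
        unfolding rotate by (simp add: sum.atLeast1_atMost_eq)
      finally show "(\<Sum>i=1..p div 2. xbar (2 * int i - 1)) = (\<Sum>i=1..p div 2. a (2 * i - 2))"
        by (simp add: m_def)
    qed
  qed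
qed

end
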